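(* Let $B_r=B_r(\vec x_0)\subseteq\mathbb{R}^n$ be an open ball and let $P,Q$ be real polynomials in $n$ variables with $Q\not\equiv 0$. If the function $s:B_r\to\mathbb{R}$ defined by $$s(\vec x)=\begin{cases}\dfrac{P(\vec x)}{Q(\vec x)} & \text{for }\vec x\in B_r\setminus\mathcal{Z}(Q),\\[2mm] 0 & \text{for }\vec x\in B_r\cap\mathcal{Z}(Q)\end{cases}$$ is continuous on $B_r$, then there exists a rational number $\varphi>0$ such that the function $$s_\varphi(\vec x)=\begin{cases}\dfrac{|P(\vec x)|}{|Q(\vec x)|^{1+\varphi}} & \text{for }\vec x\in B_r\setminus\mathcal{Z}(Q),\\[2mm] 0 & \text{for }\vec x\in B_r\cap\mathcal{Z}(Q)\end{cases}$$ is continuous on $B_r$.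
   Context: For a real polynomial $F$ in $n$ variables, $\mathcal{Z}(F)=\{\vec x\in\mathbb{R}^n: F(\vec x)=0\}$. $B_r(\vec x_0)$ denotes the open Euclidean ball of radius $r>0$ and center $\vec x_0$ in $\mathbb{R}^n$. *)

theory Defs
  imports "HOL-Analysis.Analysis"
begin

text \<open>
  A real polynomial in the variables \<open>x $ i\<close> is identified with the polynomial function it
  induces on \<open>real ^ 'n\<close> (\<^const>\<open>real_polynomial_function\<close>). Since the reals are infinite,
  this loses no information; in particular the zero polynomial is the constant function 0.
\<close>

definition zero_set :: "(real ^ 'n \<Rightarrow> real) \<Rightarrow> (real ^ 'n) set"
  where "zero_set F = {x. F x = 0}"

text \<open>
  The functions \<open>s\<close> and \<open>s\<^sub>\<phi>\<close> are total here; only their values on the ball matter.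
  The base of \<open>powr\<close> is positive wherever the first branch of \<open>s_pow\<close> is taken.
\<close>

definition s_fun :: "(real ^ 'n \<Rightarrow> real) \<Rightarrow> (real ^ 'n \<Rightarrow> real) \<Rightarrow> real ^ 'n \<Rightarrow> real"
  where "s_fun P Q x = (if x \<notin> zero_set Q then P x / Q x else 0)"

definition s_pow :: "rat \<Rightarrow> (real ^ 'n \<Rightarrow> real) \<Rightarrow> (real ^ 'n \<Rightarrow> real) \<Rightarrow> real ^ 'n \<Rightarrow> real"
  where "s_pow \<phi> P Q x =
    (if x \<notin> zero_set Q then \<bar>P x\<bar> / \<bar>Q x\<bar> powr (1 + real_of_rat \<phi>) else 0)"

end

theory Submission
  imports Defs "Jordan_Normal_Form.Char_Poly"
begin

text \<open>
  This is a Lojasiewicz inequality with an exponent that is uniform in the centre \<open>z\<close>. Since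
  \<open>P = s Q\<close> on the ball, it suffices to bound \<open>P\<^sup>2\<close> by a constant times \<open>|Q|\<close> to some power
  \<open>2 + b\<close> near each zero \<open>z\<close> of \<open>Q\<close>, with \<open>b > 0\<close> independent of \<open>z\<close>. For small \<open>t > 0\<close> let
  \<open>M t\<close> be the maximum of \<open>t P\<^sup>2 - Q^4 - t^3 \<Sum>\<^sub>i (x\<^sub>i - z\<^sub>i)^k\<close> over a small cube around \<open>z\<close>. As
  \<open>s\<close> tends to 0 at the zeros of \<open>Q\<close>, \<open>M t = t\<^sup>2 w t\<close> with \<open>w t \<longlongrightarrow> 0\<close>. In each coordinate a
  maximum lies on the boundary of the cube or is critical, and thanks to the penalty term these
  equations express \<open>t^3 (x\<^sub>i - z\<^sub>i)^(k+1)\<close> by terms of degree at most \<open>k\<close>. Hence, up to powers of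
  \<open>t\<close>, multiplication by the penalised function acts on the \<open>N = (k+1)^n\<close> monomials of degree at
  most \<open>k\<close> in each variable by a matrix over \<open>\<real>[t]\<close>, and its characteristic polynomial annihilates
  \<open>M t\<close>. A root \<open>w\<close> that tends to 0 satisfies \<open>w t ^ N \<le> C t\<close>, so
  \<open>P\<^sup>2 \<le> Q^4 / t + C t\<^sup>2 + t w t\<close>, and a suitable power of \<open>|Q|\<close> as \<open>t\<close> gives the claim.
\<close>

no_notation Matrix.vec_index (infixl "$" 100)

subsection \<open>Polynomial families with a parameter\<close>

definition mono_fun :: "('n::finite \<Rightarrow> nat) \<Rightarrow> real ^ 'n \<Rightarrow> real"
  where "mono_fun \<alpha> x = (\<Prod>i\<in>UNIV. x $ i ^ \<alpha> i)"

lemma mono_fun_0 [simp]: "mono_fun (\<lambda>_. 0) x = 1"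
  by (simp add: mono_fun_def)

lemma mono_fun_add: "mono_fun (\<lambda>i. \<alpha> i + \<beta> i) x = mono_fun \<alpha> x * mono_fun \<beta> x"
  by (simp add: mono_fun_def power_add prod.distrib)

lemma mono_fun_single [simp]: "mono_fun (\<lambda>j. if j = i then m else 0) x = x $ i ^ m"
  by (simp add: mono_fun_def if_distrib[of "\<lambda>m. _ ^ m"] cong: if_cong)

text \<open>The degree bound \<open>d\<close> only concerns \<open>x\<close>; the degree in the parameter \<open>t\<close> is unrestricted.\<close>

inductive param_poly :: "nat \<Rightarrow> (real \<Rightarrow> real ^ 'n::finite \<Rightarrow> real) \<Rightarrow> bool" where
  monom: "sum \<alpha> UNIV \<le> d \<Longrightarrow> param_poly d (\<lambda>t x. poly c t * mono_fun \<alpha> x)"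
| add: "param_poly d f \<Longrightarrow> param_poly d g \<Longrightarrow> param_poly d (\<lambda>t x. f t x + g t x)"

lemma param_poly_mono: "param_poly d f \<Longrightarrow> d \<le> e \<Longrightarrow> param_poly e f"
  by (induction rule: param_poly.induct) (auto intro: param_poly.intros)

lemma param_poly_coeff: "param_poly d (\<lambda>t x. poly c t)"
  using param_poly.monom[of "\<lambda>_. 0" d c] by simp

lemma param_poly_const: "param_poly d (\<lambda>t x. c)"
  using param_poly_coeff[of d "[:c:]"] by simp

lemma param_poly_var_power: "m \<le> d \<Longrightarrow> param_poly d (\<lambda>t x. x $ i ^ m)"
  using param_poly.monom[of "\<lambda>j. if j = i then m else 0" d 1] by simp

lemma param_poly_mult:
  assumes "param_poly d f" "param_poly e g"
  shows "param_poly (d + e) (\<lambda>t x. f t x * g t x)"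
  using assms(1)
proof (induction rule: param_poly.induct)
  case (monom \<alpha> d c)
  from assms(2) show ?case
  proof (induction rule: param_poly.induct)
    case (monom \<beta> e b)
    have "param_poly (d + e) (\<lambda>t x. poly (c * b) t * mono_fun (\<lambda>i. \<alpha> i + \<beta> i) x)"
      using monom \<open>sum \<alpha> UNIV \<le> d\<close> by (intro param_poly.monom) (simp add: sum.distrib)
    then show ?case by (simp add: mono_fun_add mult_ac)
  next
    case (add e g h)
    then show ?case by (simp add: distrib_left param_poly.add)
  qed
next
  case (add d f h)
  then show ?case by (simp add: distrib_right param_poly.add)
qed

lemma param_poly_cmult: "param_poly d f \<Longrightarrow> param_poly d (\<lambda>t x. poly c t * f t x)"
  using param_poly_mult[OF param_poly_coeff[of 0 c]] by simp

lemma param_poly_scale: "param_poly d f \<Longrightarrow> param_poly d (\<lambda>t x. c * f t x)"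
  using param_poly_cmult[of d f "[:c:]"] by simp

lemma param_poly_diff:
  "param_poly d f \<Longrightarrow> param_poly d g \<Longrightarrow> param_poly d (\<lambda>t x. f t x - g t x)"
  using param_poly.add[OF _ param_poly_scale[of d g "-1"]] by simp

lemma param_poly_power: "param_poly d f \<Longrightarrow> param_poly (m * d) (\<lambda>t x. f t x ^ m)"
  by (induction m) (auto intro: param_poly_const param_poly_mult)

lemma param_poly_sum:
  "(\<And>i. i \<in> I \<Longrightarrow> param_poly d (f i)) \<Longrightarrow> param_poly d (\<lambda>t x. \<Sum>i\<in>I. f i t x)"
  by (induction I rule: infinite_finite_induct) (auto intro: param_poly_const param_poly.add)

text \<open>Translation does not raise the degree, so \<open>d\<close> can be chosen before
  \<open>z\<close>. This order of quantifiers is what later makes the exponent independent of the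
  centre.\<close>

lemma param_poly_of_real_polynomial_function:
  assumes "real_polynomial_function P"
  shows "\<exists>d. \<forall>z. param_poly d (\<lambda>t x. P (z + x))"
  using assms
proof (induction rule: real_polynomial_function.induct)
  case (linear f)
  then interpret bounded_linear f .
  \<comment> \<open>Only the constant term depends on \<open>z\<close>; the exponent 1 is written
    out to match \<open>param_poly_var_power\<close>.\<close>
  have *: "f (z + x) = f z + (\<Sum>i\<in>UNIV. f (axis i 1) * x $ i ^ 1)" for z x
  proof -
    have "f x = f (\<Sum>i\<in>UNIV. x $ i *\<^sub>R axis i 1)"
      by (simp add: basis_expansion flip: scalar_mult_eq_scaleR)
    then show ?thesis by (simp add: add sum scaleR mult.commute)
  qed
  show ?case
    unfolding * by (intro exI[of _ 1] allI param_poly.add param_poly_const param_poly_sum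
      param_poly_scale param_poly_var_power) simp
next
  case (const c)
  show ?case by (intro exI[of _ 0] allI param_poly_const)
next
  case (add f g)
  then obtain d e where "\<And>z. param_poly d (\<lambda>t x. f (z + x))" "\<And>z. param_poly e (\<lambda>t x. g (z + x))"
    by blast
  then show ?case
    by (intro exI[of _ "max d e"] allI param_poly.add) (blast intro: param_poly_mono max.cobounded1 max.cobounded2)+
next
  case (mult f g)
  then obtain d e where "\<And>z. param_poly d (\<lambda>t x. f (z + x))" "\<And>z. param_poly e (\<lambda>t x. g (z + x))"
    by blast
  then show ?case
    by (intro exI[of _ "d + e"] allI param_poly_mult)
qed

section \<open>Partial derivatives of polynomial families\<close>

lemma mono_fun_split:
  "mono_fun \<alpha> x = x $ i ^ \<alpha> i * (\<Prod>j\<in>UNIV-{i}. x $ j ^ \<alpha> j)"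
  by (simp add: mono_fun_def prod.remove)

text \<open>For \<open>\<alpha> i = 0\<close> the truncated difference \<open>\<alpha> i - 1\<close>
  is harmless, because the factor \<open>\<alpha> i\<close> vanishes.\<close>

lemma mono_fun_partial:
  "((\<lambda>s. mono_fun \<alpha> (x + s *\<^sub>R axis i 1)) has_real_derivative
     \<alpha> i * mono_fun (\<alpha>(i := \<alpha> i - 1)) x) (at 0)"
proof -
  have "mono_fun \<alpha> (x + s *\<^sub>R axis i 1) = (x $ i + s) ^ \<alpha> i * (\<Prod>j\<in>UNIV-{i}. x $ j ^ \<alpha> j)" for s
    by (subst mono_fun_split[of _ _ i]) (auto simp: axis_def intro!: prod.cong)
  moreover have "((\<lambda>s. (x $ i + s) ^ \<alpha> i * (\<Prod>j\<in>UNIV-{i}. x $ j ^ \<alpha> j)) has_real_derivative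
     \<alpha> i * mono_fun (\<alpha>(i := \<alpha> i - 1)) x) (at 0)"
    by (subst mono_fun_split[of _ _ i]) (auto intro!: derivative_eq_intros prod.cong simp: mult_ac)
  ultimately show ?thesis by presburger
qed

text \<open>Keeping the bound \<open>d\<close> instead of lowering it to \<open>d - 1\<close> avoids
  a separate case \<open>d = 0\<close>; the loss is absorbed by the later choice
  \<open>k = 2 * d + 2\<close>.\<close>

lemma param_poly_partial:
  assumes "param_poly d f"
  shows "\<exists>f'. param_poly d f' \<and>
    (\<forall>t x. ((\<lambda>s. f t (x + s *\<^sub>R axis i 1)) has_real_derivative f' t x) (at 0))"
  using assms
proof (induction rule: param_poly.induct)
  case (monom \<alpha> d c)
  have "sum (\<alpha>(i := \<alpha> i - 1)) UNIV \<le> sum \<alpha> UNIV"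
    by (intro sum_mono) auto
  with monom have "param_poly d (\<lambda>t x. \<alpha> i * (poly c t * mono_fun (\<alpha>(i := \<alpha> i - 1)) x))"
    by (intro param_poly_scale param_poly.monom) simp
  moreover have "((\<lambda>s. poly c t * mono_fun \<alpha> (x + s *\<^sub>R axis i 1)) has_real_derivative
      \<alpha> i * (poly c t * mono_fun (\<alpha>(i := \<alpha> i - 1)) x)) (at 0)" for t x
    using DERIV_cmult[OF mono_fun_partial[of \<alpha> x i], of "poly c t"] by (simp add: mult_ac)
  ultimately show ?case by blast
next
  case (add d f g)
  then obtain f' g' where "param_poly d f'" "param_poly d g'"
    "\<And>t x. ((\<lambda>s. f t (x + s *\<^sub>R axis i 1)) has_real_derivative f' t x) (at 0)"
    "\<And>t x. ((\<lambda>s. g t (x + s *\<^sub>R axis i 1)) has_real_derivative g' t x) (at 0)"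
    by blast
  then show ?case
    by (intro exI[of _ "\<lambda>t x. f' t x + g' t x"]) (auto intro: param_poly.add DERIV_add)
qed

subsection \<open>Elimination by a characteristic polynomial\<close>

text \<open>The hypotheses make \<open>y\<close> an eigenvalue, with eigenvector \<open>v\<close>,
  of the matrix \<open>C\<close> evaluated at \<open>t\<close>. The characteristic polynomial is
  formed over \<real>[t] before \<open>t\<close> is specialised, so one monic \<open>p\<close>
  serves all \<open>t\<close>, \<open>y\<close> and \<open>v\<close>.\<close>

lemma family_char_poly:
  fixes C :: "'a \<Rightarrow> 'a \<Rightarrow> real poly"
  assumes "finite R"
  obtains p :: "real poly poly" where "degree p = card R" "lead_coeff p = 1"
    "\<And>t y v. \<lbrakk>\<exists>a\<in>R. v a \<noteq> 0; \<And>b. b \<in> R \<Longrightarrow> y * v b = (\<Sum>a\<in>R. poly (C b a) t * v a)\<rbrakk>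
      \<Longrightarrow> poly (map_poly (\<lambda>c. poly c t) p) y = 0"
proof -
  define N where "N = card R"
  obtain h where h: "bij_betw h {0..<N} R"
    using ex_bij_betw_nat_finite[OF assms] by (auto simp: N_def)
  define M where "M = mat N N (\<lambda>(i, j). C (h i) (h j))"
  have M: "M \<in> carrier_mat N N" by (simp add: M_def)
  show thesis
  proof (rule that[of "char_poly M"])
    show "degree (char_poly M) = card R" "lead_coeff (char_poly M) = 1"
      using degree_monic_char_poly[OF M] by (auto simp: N_def)
    fix t y :: real and v :: "'a \<Rightarrow> real"
    assume ne: "\<exists>a\<in>R. v a \<noteq> 0" and eq: "\<And>b. b \<in> R \<Longrightarrow> y * v b = (\<Sum>a\<in>R. poly (C b a) t * v a)"
    \<comment> \<open>Evaluation at \<open>t\<close> is a ring homomorphism and therefore commutes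
      with taking the characteristic polynomial.\<close>
    have ev: "comm_ring_hom (\<lambda>c :: real poly. poly c t)" by unfold_locales auto
    define Mt where "Mt = map_mat (\<lambda>c. poly c t) M"
    define u where "u = vec N (\<lambda>i. v (h i))"
    have Mt: "Mt \<in> carrier_mat N N" using M by (simp add: Mt_def)
    have "Mt *\<^sub>v u = y \<cdot>\<^sub>v u"
    proof (rule eq_vecI)
      fix i assume "i < dim_vec (y \<cdot>\<^sub>v u)"
      then have i: "i < N" by (simp add: u_def)
      then have hi: "h i \<in> R" using h by (auto simp: bij_betw_def)
      have "vec_index (Mt *\<^sub>v u) i = (\<Sum>j = 0..<N. poly (C (h i) (h j)) t * v (h j))"
        using i by (simp add: Mt_def M_def u_def scalar_prod_def)
      also have "\<dots> = (\<Sum>a\<in>R. poly (C (h i) a) t * v a)"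
        by (rule sum.reindex_bij_betw[OF h])
      also have "\<dots> = vec_index (y \<cdot>\<^sub>v u) i"
        using i eq[OF hi] by (simp add: u_def)
      finally show "vec_index (Mt *\<^sub>v u) i = vec_index (y \<cdot>\<^sub>v u) i" .
    qed (simp add: u_def Mt_def M_def)
    moreover have "u \<noteq> 0\<^sub>v N"
    proof
      assume z: "u = 0\<^sub>v N"
      obtain a where a: "a \<in> R" "v a \<noteq> 0" using ne by blast
      obtain i where "i < N" "a = h i" using a(1) h by (auto simp: bij_betw_def)
      then show False using a(2) arg_cong[OF z, of "\<lambda>x. vec_index x i"] by (simp add: u_def)
    qed
    ultimately have "eigenvalue Mt y"
      unfolding eigenvalue_def eigenvector_def using Mt by (intro exI[of _ u]) (auto simp: u_def)
    then show "poly (map_poly (\<lambda>c. poly c t) (char_poly M)) y = 0"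
      using eigenvalue_root_char_poly[OF Mt] comm_ring_hom.char_poly_hom[OF ev M] by (simp add: Mt_def)
  qed
qed

section \<open>Reduction to monomials of bounded degree in each variable\<close>

definition exponents_upto :: "nat \<Rightarrow> ('n::finite \<Rightarrow> nat) set"
  where "exponents_upto k = {\<alpha>. \<forall>i. \<alpha> i \<le> k}"

lemma finite_exponents_upto: "finite (exponents_upto k :: ('n::finite \<Rightarrow> nat) set)"
proof -
  have "(exponents_upto k :: ('n \<Rightarrow> nat) set) = Pi\<^sub>E UNIV (\<lambda>_. {..k})"
    by (auto simp: exponents_upto_def)
  then show ?thesis by (simp add: finite_PiE)
qed

lemma card_exponents_upto_pos: "card (exponents_upto k :: ('n::finite \<Rightarrow> nat) set) > 0"
proof -
  have "(\<lambda>_. 0) \<in> (exponents_upto k :: ('n \<Rightarrow> nat) set)" by (simp add: exponents_upto_def)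
  then show ?thesis using finite_exponents_upto card_gt_0_iff by blast
qed

locale reduction_system =
  fixes k m :: nat and R :: "'n::finite \<Rightarrow> real \<Rightarrow> real ^ 'n \<Rightarrow> real"
  assumes R: "\<And>i. param_poly k (R i)"
begin

definition solution :: "real \<Rightarrow> real ^ 'n \<Rightarrow> bool"
  where "solution t x \<longleftrightarrow> (\<forall>i. t ^ m * x $ i ^ Suc k = R i t x)"

text \<open>The factor \<open>t ^ e\<close> clears the denominators from dividing by the leading coefficient \<open>t ^ m\<close>.\<close>

definition reducible :: "(real \<Rightarrow> real ^ 'n \<Rightarrow> real) \<Rightarrow> nat \<Rightarrow> bool"
  where "reducible f e \<longleftrightarrow> (\<exists>c. \<forall>t x. solution t x \<longrightarrow>
    t ^ e * f t x = (\<Sum>\<alpha>\<in>exponents_upto k. poly (c \<alpha>) t * mono_fun \<alpha> x))"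

lemma reducible_cmult:
  assumes "reducible f e"
  shows "reducible (\<lambda>t x. poly b t * f t x) e"
proof -
  obtain c where c: "\<And>t x. solution t x \<Longrightarrow>
      t ^ e * f t x = (\<Sum>\<alpha>\<in>exponents_upto k. poly (c \<alpha>) t * mono_fun \<alpha> x)"
    using assms unfolding reducible_def by blast
  have "t ^ e * (poly b t * f t x) = (\<Sum>\<alpha>\<in>exponents_upto k. poly (b * c \<alpha>) t * mono_fun \<alpha> x)"
    if "solution t x" for t x
    using arg_cong[OF c[OF that], of "\<lambda>y. poly b t * y"] by (simp add: sum_distrib_left mult_ac)
  then show ?thesis
    unfolding reducible_def by (intro exI[of _ "\<lambda>\<alpha>. b * c \<alpha>"]) auto
qed

lemma reducible_add:
  assumes "reducible f e" "reducible g e"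
  shows "reducible (\<lambda>t x. f t x + g t x) e"
proof -
  obtain b c where "\<And>t x. solution t x \<Longrightarrow>
      t ^ e * f t x = (\<Sum>\<alpha>\<in>exponents_upto k. poly (b \<alpha>) t * mono_fun \<alpha> x)"
    "\<And>t x. solution t x \<Longrightarrow>
      t ^ e * g t x = (\<Sum>\<alpha>\<in>exponents_upto k. poly (c \<alpha>) t * mono_fun \<alpha> x)"
    using assms unfolding reducible_def by blast
  then show ?thesis unfolding reducible_def
    by (intro exI[of _ "\<lambda>\<alpha>. b \<alpha> + c \<alpha>"]) (simp add: algebra_simps sum.distrib)
qed

lemma reducible_raise:
  assumes "reducible f e" "e \<le> e'"
  shows "reducible f e'"
proof -
  have "reducible (\<lambda>t x. poly (monom 1 (e' - e)) t * f t x) e"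
    by (rule reducible_cmult[OF assms(1)])
  moreover have "t ^ e * (poly (monom 1 (e' - e)) t * y) = t ^ e' * y" for t y :: real
    using assms(2) by (simp add: poly_monom flip: power_add mult.assoc)
  ultimately show ?thesis unfolding reducible_def by simp
qed

text \<open>The second assumption is restricted to monomials of degree at most \<open>d\<close> so
  that the lemma can be applied inside the induction on degree in
  \<open>reducible_mono_fun\<close>.\<close>

lemma reducible_param_poly:
  assumes "param_poly d f"
    and "\<And>\<alpha>. sum \<alpha> UNIV \<le> d \<Longrightarrow> \<exists>e. reducible (\<lambda>t. mono_fun \<alpha>) e"
  shows "\<exists>e. reducible f e"
  using assms
proof (induction rule: param_poly.induct)
  case (monom \<alpha> d c)
  then show ?case using reducible_cmult by blast
next
  case (add d f g)
  then obtain e1 e2 where "reducible f e1" "reducible g e2" by blast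
  then have "reducible f (max e1 e2)" "reducible g (max e1 e2)"
    by (auto elim: reducible_raise)
  then show ?case using reducible_add by blast
qed

text \<open>Induction on the total degree. If some exponent exceeds \<open>k\<close>, a factor
  \<open>x $ i ^ Suc k\<close> is replaced by \<open>R i\<close>; as \<open>R i\<close> has total
  degree at most \<open>k\<close>, every resulting monomial has smaller total degree.\<close>

lemma reducible_mono_fun: "\<exists>e. reducible (\<lambda>t. mono_fun \<alpha>) e"
proof (induction "sum \<alpha> UNIV" arbitrary: \<alpha> rule: less_induct)
  case less
  show ?case
  proof (cases "\<alpha> \<in> exponents_upto k")
    case True
    have "poly (if \<beta> = \<alpha> then 1 else 0) t * mono_fun \<beta> x = (if \<beta> = \<alpha> then mono_fun \<alpha> x else 0)"
      for t \<beta> and x :: "real ^ 'n" by simp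
    then have "mono_fun \<alpha> x = (\<Sum>\<beta>\<in>exponents_upto k. poly (if \<beta> = \<alpha> then 1 else 0) t * mono_fun \<beta> x)"
      for t and x :: "real ^ 'n"
      using True finite_exponents_upto by (simp only: sum.delta[OF finite_exponents_upto] if_True)
    then have "reducible (\<lambda>t. mono_fun \<alpha>) 0"
      unfolding reducible_def by (intro exI[of _ "\<lambda>\<beta>. if \<beta> = \<alpha> then 1 else 0"]) simp
    then show ?thesis ..
  next
    case False
    then obtain i where i: "\<alpha> i > k" by (auto simp: exponents_upto_def not_le)
    define \<beta> where "\<beta> = \<alpha>(i := \<alpha> i - Suc k)"
    have \<alpha>: "\<alpha> = (\<lambda>j. (if j = i then Suc k else 0) + \<beta> j)"
      using i by (auto simp: \<beta>_def)
    then have deg: "sum \<alpha> UNIV = Suc k + sum \<beta> UNIV"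
      by (subst \<alpha>) (simp add: sum.distrib)
    have mono: "mono_fun \<alpha> x = x $ i ^ Suc k * mono_fun \<beta> x" for x
      by (subst \<alpha>) (simp only: mono_fun_add mono_fun_single)
    have "param_poly (k + sum \<beta> UNIV) (\<lambda>t x. R i t x * mono_fun \<beta> x)"
      using param_poly_mult[OF R[of i] param_poly.monom[of \<beta> "sum \<beta> UNIV" 1]] by simp
    then have "\<exists>e. reducible (\<lambda>t x. R i t x * mono_fun \<beta> x) e"
    proof (rule reducible_param_poly)
      fix \<gamma> :: "'n \<Rightarrow> nat" assume "sum \<gamma> UNIV \<le> k + sum \<beta> UNIV"
      then have "sum \<gamma> UNIV < sum \<alpha> UNIV" using deg by linarith
      then show "\<exists>e. reducible (\<lambda>t. mono_fun \<gamma>) e" by (rule less)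
    qed
    then obtain e where "reducible (\<lambda>t x. R i t x * mono_fun \<beta> x) e" ..
    \<comment> \<open>The replacement of \<open>x $ i ^ Suc k\<close> uses up one factor
      \<open>t ^ m\<close>, hence the exponent \<open>e + m\<close>.\<close>
    moreover have "t ^ (e + m) * mono_fun \<alpha> x = t ^ e * (R i t x * mono_fun \<beta> x)"
      if "solution t x" for t x
      using that[unfolded solution_def, rule_format, of i, symmetric]
      by (simp add: mono power_add mult_ac)
    ultimately have "reducible (\<lambda>t. mono_fun \<alpha>) (e + m)"
      unfolding reducible_def by simp
    then show ?thesis ..
  qed
qed

text \<open>On solutions, multiplication by \<open>t ^ E * F t x\<close> maps each monomial in
  \<open>exponents_upto k\<close> to a combination of such monomials with coefficients in
  \<real>[t]. Their values at \<open>x\<close> form an eigenvector, nonzero because the constant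
  monomial is 1. The degree of \<open>p\<close> depends only on \<open>k\<close> and the number of
  variables.\<close>

lemma algebraic_on_solutions:
  assumes "param_poly d F"
  obtains p E where "degree p = card (exponents_upto k :: ('n \<Rightarrow> nat) set)" "lead_coeff p = (1 :: real poly)"
    "\<And>t x. solution t x \<Longrightarrow> poly (map_poly (\<lambda>c. poly c t) p) (t ^ E * F t x) = 0"
proof -
  have "\<exists>e. reducible (\<lambda>t x. F t x * mono_fun \<beta> x) e" for \<beta>
    using reducible_param_poly[OF param_poly_mult[OF assms param_poly.monom[of \<beta> _ 1, OF order_refl]]]
      reducible_mono_fun by simp
  then obtain e where e: "\<And>\<beta>. reducible (\<lambda>t x. F t x * mono_fun \<beta> x) (e \<beta>)"
    by metis
  \<comment> \<open>A common bound for the finitely many exponents \<open>e \<beta>\<close>, so that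
    one power of \<open>t\<close> clears all denominators.\<close>
  define E where "E = sum e (exponents_upto k)"
  have "reducible (\<lambda>t x. F t x * mono_fun \<beta> x) E" if "\<beta> \<in> exponents_upto k" for \<beta>
    unfolding E_def using that by (intro reducible_raise[OF e] member_le_sum finite_exponents_upto) auto
  then obtain C where C: "\<And>\<beta> t x. \<beta> \<in> exponents_upto k \<Longrightarrow> solution t x \<Longrightarrow>
      t ^ E * (F t x * mono_fun \<beta> x) = (\<Sum>\<alpha>\<in>exponents_upto k. poly (C \<beta> \<alpha>) t * mono_fun \<alpha> x)"
    unfolding reducible_def by metis
  obtain p :: "real poly poly" where p: "degree p = card (exponents_upto k :: ('n \<Rightarrow> nat) set)" "lead_coeff p = 1"
    "\<And>t y v. \<lbrakk>\<exists>a\<in>exponents_upto k. v a \<noteq> 0; \<And>b. b \<in> exponents_upto k \<Longrightarrow> y * v b = (\<Sum>a\<in>exponents_upto k. poly (C b a) t * v a)\<rbrakk>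
      \<Longrightarrow> poly (map_poly (\<lambda>c. poly c t) p) y = 0"
    using family_char_poly[OF finite_exponents_upto[of k], of C] by blast
  show thesis
  proof (rule that[of p E])
    fix t x assume sol: "solution t x"
    show "poly (map_poly (\<lambda>c. poly c t) p) (t ^ E * F t x) = 0"
    proof (rule p(3)[of "\<lambda>\<alpha>. mono_fun \<alpha> x"])
      show "\<exists>\<alpha>\<in>exponents_upto k. mono_fun \<alpha> x \<noteq> 0"
        by (intro bexI[of _ "\<lambda>_. 0"]) (auto simp: exponents_upto_def)
    qed (use C sol in \<open>simp add: mult.assoc\<close>)
  qed (use p in auto)
qed

end

subsection \<open>Small roots of algebraic equations\<close>

text \<open>Take the largest power of t dividing all coefficients. If all quotients vanished at 0,
  another factor t could be divided out. The quotients thus give an equation that does not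
  degenerate at t = 0.\<close>

lemma factor_out_common_power:
  fixes a :: "nat \<Rightarrow> real poly"
  assumes "\<exists>k\<le>N. a k \<noteq> 0"
  obtains v b where "\<And>k. k \<le> N \<Longrightarrow> a k = monom 1 v * b k" "\<exists>k\<le>N. poly (b k) 0 \<noteq> 0"
proof -
  obtain k0 where k0: "k0 \<le> N" "a k0 \<noteq> 0" using assms by blast
  define D where "D = {v. \<forall>k\<le>N. monom 1 v dvd a k}"
  have "v \<le> degree (a k0)" if "v \<in> D" for v
    using that k0 dvd_imp_degree_le[of "monom 1 v" "a k0"] by (simp add: D_def degree_monom_eq)
  moreover have "0 \<in> D" by (simp add: D_def)
  ultimately obtain v where v: "v \<in> D" "\<And>u. u \<in> D \<Longrightarrow> u \<le> v"
    using Max_in[of D] Max_ge[of D] finite_nat_set_iff_bounded_le[of D] by blast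
  from v(1) have "\<forall>k. \<exists>b. k \<le> N \<longrightarrow> a k = monom 1 v * b" by (auto simp: D_def elim: dvdE)
  then obtain b where b: "\<And>k. k \<le> N \<Longrightarrow> a k = monom 1 v * b k" by metis
  have "\<exists>k\<le>N. poly (b k) 0 \<noteq> 0"
  proof (rule ccontr)
    assume "\<not> ?thesis"
    then have "monom 1 1 dvd b k" if "k \<le> N" for k
      using that poly_eq_0_iff_dvd[of "b k" 0] by (simp add: monom_altdef)
    then have "monom 1 v * monom 1 1 dvd a k" if "k \<le> N" for k
      using that b by (metis mult_dvd_mono dvd_refl)
    then have "Suc v \<in> D" by (simp add: D_def mult_monom)
    then show False using v(2) by fastforce
  qed
  with b show thesis using that by blast
qed

text \<open>Let \<open>j\<close> be the least index with \<open>poly (b j) 0 \<noteq> 0\<close>.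
  Near 0 the terms below \<open>j\<close> are of order t, and those above \<open>j\<close> are
  absorbed by the term at \<open>j\<close> because \<open>w\<close> tends to 0. Hence
  \<open>w t ^ j\<close> is of order t, and so is \<open>w t ^ N\<close> once
  \<open>w t \<le> 1\<close>.\<close>

lemma small_root_bound:
  fixes b :: "nat \<Rightarrow> real poly" and w :: "real \<Rightarrow> real"
  assumes "\<exists>k\<le>N. poly (b k) 0 \<noteq> 0" "N \<ge> 1"
    and w: "(w \<longlongrightarrow> 0) (at_right 0)"
    and ev: "\<forall>\<^sub>F t in at_right 0. w t \<ge> 0 \<and> (\<Sum>k\<le>N. poly (b k) t * w t ^ k) = 0"
  shows "\<exists>C>0. \<forall>\<^sub>F t in at_right 0. w t ^ N \<le> C * t"
proof -
  define j where "j = (LEAST k. poly (b k) 0 \<noteq> 0)"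
  obtain k0 where "k0 \<le> N" "poly (b k0) 0 \<noteq> 0" using assms(1) by blast
  then have j: "poly (b j) 0 \<noteq> 0" "j \<le> N"
    using LeastI[of "\<lambda>k. poly (b k) 0 \<noteq> 0" k0] Least_le[of "\<lambda>k. poly (b k) 0 \<noteq> 0" k0]
    unfolding j_def by auto
  have low: "poly (b k) 0 = 0" if "k < j" for k
    using that not_less_Least unfolding j_def by blast
  have "\<exists>q. k < j \<longrightarrow> b k = [:0, 1:] * q" for k
    using low[of k] poly_eq_0_iff_dvd[of "b k" 0] by (auto elim: dvdE)
  then obtain q where q: "\<And>k. k < j \<Longrightarrow> b k = [:0, 1:] * q k" by metis
  define c where "c = \<bar>poly (b j) 0\<bar> / 2"
  have c: "c > 0" using j by (simp add: c_def)
  \<comment> \<open>Each summand 1 is slack for passing from the value of a coefficient at 0 to its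
    values near 0.\<close>
  define B where "B = (\<Sum>k\<le>N. \<bar>poly (b k) 0\<bar> + 1) + (\<Sum>k<j. \<bar>poly (q k) 0\<bar> + 1)"
  have poly_tendsto: "((\<lambda>t. \<bar>poly p t\<bar>) \<longlongrightarrow> \<bar>poly p 0\<bar>) (at_right 0)" for p :: "real poly"
    by (intro tendsto_intros)
  have ev_le: "\<forall>\<^sub>F t in at_right 0. \<bar>poly p t\<bar> \<le> \<bar>poly p 0\<bar> + 1" for p :: "real poly"
    using order_tendstoD(2)[OF poly_tendsto[of p], of "\<bar>poly p 0\<bar> + 1"] by (auto elim: eventually_mono)
  have "B \<ge> 0" by (auto simp: B_def intro!: add_nonneg_nonneg sum_nonneg)
  have e1: "\<forall>\<^sub>F t in at_right 0. \<forall>k\<in>{..N}. \<bar>poly (b k) t\<bar> \<le> \<bar>poly (b k) 0\<bar> + 1"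
    using ev_le by (intro eventually_ball_finite) auto
  have e2: "\<forall>\<^sub>F t in at_right 0. \<forall>k\<in>{..<j}. \<bar>poly (q k) t\<bar> \<le> \<bar>poly (q k) 0\<bar> + 1"
    using ev_le by (intro eventually_ball_finite) auto
  have e3: "\<forall>\<^sub>F t in at_right 0. c < \<bar>poly (b j) t\<bar>"
    using order_tendstoD(1)[OF poly_tendsto[of "b j"], of c] j by (simp add: c_def)
  \<comment> \<open>Below this threshold \<open>w t * B \<le> c / 2\<close>, so the terms above
    \<open>j\<close> consume at most half of \<open>c * w t ^ j\<close>.\<close>
  have e4: "\<forall>\<^sub>F t in at_right 0. w t < min 1 (c / (2 * (B + 1)))"
    using \<open>B \<ge> 0\<close> c by (intro order_tendstoD(2)[OF w]) auto
  have e5: "\<forall>\<^sub>F t in at_right 0. t > (0::real)" by (rule eventually_at_right_less)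
  have "\<forall>\<^sub>F t in at_right 0. w t ^ N \<le> (2 * (B + 1) / c) * t"
    using ev e1 e2 e3 e4 e5
  proof eventually_elim
    case (elim t)
    then have t: "t > 0" and w0: "0 \<le> w t" and w1: "w t \<le> 1"
      and wB: "w t \<le> c / (2 * (B + 1))" by auto
    have pw: "w t ^ k \<le> 1" for k using w0 w1 by (rule power_le_one)
    have S: "{..N} = {..<j} \<union> ({j} \<union> {j<..N})" using j by auto
    have "(\<Sum>k\<le>N. poly (b k) t * w t ^ k) =
        (\<Sum>k<j. poly (b k) t * w t ^ k) + (poly (b j) t * w t ^ j + (\<Sum>k\<in>{j<..N}. poly (b k) t * w t ^ k))"
      unfolding S by (subst sum.union_disjoint) auto
    then have eq: "poly (b j) t * w t ^ j =
        - (\<Sum>k<j. poly (b k) t * w t ^ k) - (\<Sum>k\<in>{j<..N}. poly (b k) t * w t ^ k)"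
      using elim by simp
    have l: "\<bar>\<Sum>k<j. poly (b k) t * w t ^ k\<bar> \<le> t * B"
    proof -
      have "\<bar>\<Sum>k<j. poly (b k) t * w t ^ k\<bar> \<le> (\<Sum>k<j. t * (\<bar>poly (q k) 0\<bar> + 1))"
      proof (intro sum_abs[THEN order_trans] sum_mono)
        fix k assume k: "k \<in> {..<j}"
        have "\<bar>poly (b k) t * w t ^ k\<bar> = t * (\<bar>poly (q k) t\<bar> * w t ^ k)"
          using k q[of k] t w0 by (simp add: abs_mult)
        also have "\<dots> \<le> t * ((\<bar>poly (q k) 0\<bar> + 1) * 1)"
          using elim k t w0 pw by (intro mult_left_mono mult_mono) auto
        finally show "\<bar>poly (b k) t * w t ^ k\<bar> \<le> t * (\<bar>poly (q k) 0\<bar> + 1)" by simp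
      qed
      also have "\<dots> \<le> t * B" unfolding sum_distrib_left[symmetric] B_def
        using t by (intro mult_left_mono) (auto intro: sum_nonneg)
      finally show ?thesis .
    qed
    have h: "\<bar>\<Sum>k\<in>{j<..N}. poly (b k) t * w t ^ k\<bar> \<le> w t ^ Suc j * B"
    proof -
      have "\<bar>\<Sum>k\<in>{j<..N}. poly (b k) t * w t ^ k\<bar> \<le> (\<Sum>k\<in>{j<..N}. w t ^ Suc j * (\<bar>poly (b k) 0\<bar> + 1))"
      proof (intro sum_abs[THEN order_trans] sum_mono)
        fix k assume k: "k \<in> {j<..N}"
        then have "w t ^ k \<le> w t ^ Suc j" using w0 w1 by (intro power_decreasing) auto
        then have "\<bar>poly (b k) t\<bar> * w t ^ k \<le> (\<bar>poly (b k) 0\<bar> + 1) * w t ^ Suc j"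
          using elim k w0 by (intro mult_mono) auto
        then show "\<bar>poly (b k) t * w t ^ k\<bar> \<le> w t ^ Suc j * (\<bar>poly (b k) 0\<bar> + 1)"
          using w0 by (simp add: abs_mult mult.commute)
      qed
      also have "\<dots> \<le> w t ^ Suc j * (\<Sum>k\<le>N. \<bar>poly (b k) 0\<bar> + 1)"
        unfolding sum_distrib_left[symmetric] using w0 by (intro mult_left_mono sum_mono2) auto
      also have "\<dots> \<le> w t ^ Suc j * B"
        using w0 by (intro mult_left_mono) (auto simp: B_def intro: sum_nonneg)
      finally show ?thesis .
    qed
    have "c * w t ^ j \<le> \<bar>poly (b j) t\<bar> * w t ^ j"
      using elim w0 by (intro mult_right_mono) auto
    also have "\<dots> = \<bar>poly (b j) t * w t ^ j\<bar>" using w0 by (simp add: abs_mult)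
    also have "\<dots> \<le> t * B + w t ^ Suc j * B" using eq l h by linarith
    also have "w t ^ Suc j * B \<le> c / 2 * w t ^ j"
    proof -
      have "w t * B \<le> c / (2 * (B + 1)) * (B + 1)"
        using wB \<open>B \<ge> 0\<close> w0 c by (intro mult_mono) auto
      also have "\<dots> = c / 2" using \<open>B \<ge> 0\<close> by (simp add: field_simps)
      finally have "w t * B \<le> c / 2" .
      from mult_right_mono[OF this, of "w t ^ j"] show ?thesis using w0 by (simp add: mult_ac)
    qed
    finally have "c * w t ^ j \<le> 2 * (t * B)" by simp
    also have "\<dots> \<le> 2 * (B + 1) * t" using t by (simp add: algebra_simps)
    finally have "w t ^ j \<le> 2 * (B + 1) / c * t" using c by (simp add: field_simps)
    moreover have "w t ^ N \<le> w t ^ j" using j w0 w1 by (intro power_decreasing) auto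
    ultimately show ?case by simp
  qed
  moreover have "2 * (B + 1) / c > 0" using \<open>B \<ge> 0\<close> c by simp
  ultimately show ?thesis by blast
qed

text \<open>Substituting \<open>t ^ E * w t\<close> multiplies the coefficient of index k by
  \<open>t ^ (E * k)\<close>, so even the leading one may vanish at 0. Monicity still guarantees a
  nonzero coefficient, and dividing by the common power of t leads to
  \<open>small_root_bound\<close>.\<close>

lemma small_algebraic_function_bound:
  fixes p :: "real poly poly" and w :: "real \<Rightarrow> real"
  assumes p: "lead_coeff p = 1" "degree p \<ge> 1"
    and w: "(w \<longlongrightarrow> 0) (at_right 0)"
    and ev: "\<forall>\<^sub>F t in at_right 0. w t \<ge> 0 \<and> poly (map_poly (\<lambda>c. poly c t) p) (t ^ E * w t) = 0"
  shows "\<exists>C>0. \<forall>\<^sub>F t in at_right 0. w t ^ degree p \<le> C * t"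
proof -
  define a where "a k = coeff p k * monom 1 (E * k)" for k
  have "\<exists>k\<le>degree p. a k \<noteq> 0" using p by (intro exI[of _ "degree p"]) (simp add: a_def)
  then obtain v b where b: "\<And>k. k \<le> degree p \<Longrightarrow> a k = monom 1 v * b k"
    "\<exists>k\<le>degree p. poly (b k) 0 \<noteq> 0"
    using factor_out_common_power by blast
  have eq: "poly (map_poly (\<lambda>c. poly c t) p) (t ^ E * w t) = t ^ v * (\<Sum>k\<le>degree p. poly (b k) t * w t ^ k)" for t
  proof -
    have deg: "degree (map_poly (\<lambda>c. poly c t) p) = degree p"
      by (rule map_poly_degree_eq) (simp add: p)
    have "poly (map_poly (\<lambda>c. poly c t) p) (t ^ E * w t) = (\<Sum>k\<le>degree p. poly (a k) t * w t ^ k)"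
      by (subst poly_altdef)
        (simp add: deg coeff_map_poly a_def poly_monom power_mult_distrib power_mult mult.assoc)
    also have "\<dots> = t ^ v * (\<Sum>k\<le>degree p. poly (b k) t * w t ^ k)"
      by (simp add: sum_distrib_left b(1) poly_monom mult.assoc)
    finally show ?thesis .
  qed
  show ?thesis
  proof (rule small_root_bound[OF b(2) p(2) w])
    show "\<forall>\<^sub>F t in at_right 0. w t \<ge> 0 \<and> (\<Sum>k\<le>degree p. poly (b k) t * w t ^ k) = 0"
      using ev eventually_at_right_less[of "0::real"] by eventually_elim (auto simp: eq)
  qed
qed

subsection \<open>The penalised maximum\<close>

text \<open>In a cube the freedom to move a point along axis i depends on \<open>x $ i\<close>
  alone. A maximum on the boundary therefore still yields one equation per coordinate.\<close>

definition cube :: "real \<Rightarrow> (real ^ 'n) set"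
  where "cube \<rho> = {x. \<forall>i. \<bar>x $ i\<bar> \<le> \<rho>}"

lemma compact_cube: "compact (cube \<rho> :: (real ^ 'n) set)"
proof -
  have "cube \<rho> = cbox ((\<chi> i. - \<rho>) :: real ^ 'n) (\<chi> i. \<rho>)"
    by (auto simp: cube_def mem_box_cart abs_le_iff minus_le_iff)
  then show ?thesis by simp
qed

text \<open>The factor \<open>\<rho>\<^sup>2 - (x $ i)\<^sup>2\<close> merges the boundary case and
  the critical case into a single polynomial equation.\<close>

lemma maximum_on_cube_partial:
  fixes F :: "real ^ 'n \<Rightarrow> real"
  assumes x: "x \<in> cube \<rho>" "\<And>y. y \<in> cube \<rho> \<Longrightarrow> F y \<le> F x"
    and D: "((\<lambda>s. F (x + s *\<^sub>R axis i 1)) has_real_derivative D) (at 0)"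
  shows "(\<rho>\<^sup>2 - (x $ i)\<^sup>2) * D = 0"
proof (cases "\<bar>x $ i\<bar> = \<rho>")
  case False
  then have lt: "\<bar>x $ i\<bar> < \<rho>" using x(1) by (auto simp: cube_def less_le)
  have "x + s *\<^sub>R axis i 1 \<in> cube \<rho>" if "\<bar>s\<bar> < \<rho> - \<bar>x $ i\<bar>" for s
    using x(1) that unfolding cube_def axis_def by (auto simp: abs_if split: if_splits)
  then have "\<forall>s. \<bar>0 - s\<bar> < \<rho> - \<bar>x $ i\<bar> \<longrightarrow> F (x + s *\<^sub>R axis i 1) \<le> F (x + 0 *\<^sub>R axis i 1)"
    using x(2) by simp
  then have "D = 0" using DERIV_local_max[OF D, of "\<rho> - \<bar>x $ i\<bar>"] lt by simp
  then show ?thesis by simp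
qed (metis diff_self mult_zero_left power2_abs)

text \<open>The centre has been moved to the origin. \<open>C\<close> and \<open>w\<close> may
  depend on the functions and the cube, whereas \<open>N\<close> depends only on \<open>d\<close>
  and the dimension.\<close>

lemma penalised_maximum_bound:
  fixes p q s :: "real ^ 'n \<Rightarrow> real"
  assumes pp: "param_poly d (\<lambda>t x. t * p x ^ 2 - q x ^ 4)"
    and cont: "continuous_on UNIV p" "continuous_on UNIV q" "continuous_on (cube \<rho>) s"
    and ps: "\<And>x. x \<in> cube \<rho> \<Longrightarrow> p x = s x * q x"
    and sq: "\<And>x. x \<in> cube \<rho> \<Longrightarrow> q x = 0 \<Longrightarrow> s x = 0"
    and q0: "q 0 = 0" and \<rho>: "\<rho> > 0"
    and N: "N = card (exponents_upto (2 * d + 2) :: ('n \<Rightarrow> nat) set)"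
  shows "\<exists>C>0. \<exists>w. \<forall>\<^sub>F t in at_right 0. 0 \<le> w t \<and> w t ^ N \<le> C * t \<and>
    (\<forall>x\<in>cube \<rho>. (p x)\<^sup>2 \<le> q x ^ 4 / t + C * t\<^sup>2 + t * w t)"
proof -
  \<comment> \<open>An even \<open>k\<close> makes the penalty nonnegative, and
    \<open>d + 2 \<le> k\<close> leaves room for the product of a partial derivative with
    \<open>\<rho>\<^sup>2 - x $ i ^ 2\<close>.\<close>
  define k where "k = 2 * d + 2"
  \<comment> \<open>The weight \<open>t ^ 3\<close> gives the critical equations a leading
    coefficient that is nonzero for \<open>t > 0\<close>, while the penalty costs only order
    \<open>t\<^sup>2\<close> in the bound for \<open>(p x)\<^sup>2\<close>.\<close>
  define F where "F t x = t * p x ^ 2 - q x ^ 4 - t ^ 3 * (\<Sum>i\<in>UNIV. x $ i ^ k)"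
    for t :: real and x :: "real ^ 'n"
  have "\<forall>i. \<exists>f'. param_poly d f' \<and> (\<forall>t x. ((\<lambda>s. t * p (x + s *\<^sub>R axis i 1) ^ 2 - q (x + s *\<^sub>R axis i 1) ^ 4)
      has_real_derivative f' t x) (at 0))"
    using param_poly_partial[OF pp] by blast
  from choice[OF this] obtain f' where f': "\<And>i. param_poly d (f' i)"
    "\<And>i t x. ((\<lambda>s. t * p (x + s *\<^sub>R axis i 1) ^ 2 - q (x + s *\<^sub>R axis i 1) ^ 4)
      has_real_derivative f' i t x) (at 0)" by blast
  \<comment> \<open>Obtained by solving the equation of \<open>maximum_on_cube_partial\<close> for
    \<open>t ^ 3 * x $ i ^ Suc k\<close>.\<close>
  define R where "R i t x = t ^ 3 * (\<rho>\<^sup>2 * x $ i ^ (k - 1)) - (\<rho>\<^sup>2 - x $ i ^ 2) * f' i t x / k"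
    for i t and x :: "real ^ 'n"
  have R: "param_poly k (R i)" for i
  proof -
    have "param_poly k (\<lambda>t x. poly (monom 1 3) t * (\<rho>\<^sup>2 * x $ i ^ (k - 1)))"
      by (intro param_poly_cmult param_poly_scale param_poly_var_power) simp
    moreover have "param_poly (2 + d) (\<lambda>t x. (\<rho>\<^sup>2 - x $ i ^ 2) * f' i t x)"
      by (intro param_poly_mult param_poly_diff param_poly_const param_poly_var_power f') simp
    then have "param_poly k (\<lambda>t x. 1 / k * ((\<rho>\<^sup>2 - x $ i ^ 2) * f' i t x))"
      by (intro param_poly_scale) (auto elim!: param_poly_mono simp: k_def)
    ultimately show ?thesis
      unfolding R_def[abs_def] using param_poly_diff by (fastforce simp: poly_monom)
  qed
  interpret reduction_system k 3 R by unfold_locales (rule R)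
  have F_pp: "param_poly k F"
  proof -
    have "param_poly k (\<lambda>t x. poly (monom 1 3) t * (\<Sum>i\<in>UNIV. x $ i ^ k) :: real)"
      by (intro param_poly_cmult param_poly_sum param_poly_var_power) simp
    moreover have "param_poly k (\<lambda>t x. t * p x ^ 2 - q x ^ 4)"
      by (rule param_poly_mono[OF pp]) (simp add: k_def)
    ultimately show ?thesis
      unfolding F_def[abs_def] using param_poly_diff by (fastforce simp: poly_monom)
  qed
  have zero_cube: "0 \<in> cube \<rho>" using \<rho> by (simp add: cube_def)
  have contK: "continuous_on (cube \<rho>) p" "continuous_on (cube \<rho>) q"
    using cont continuous_on_subset by blast+
  have "\<exists>x\<in>cube \<rho>. \<forall>y\<in>cube \<rho>. F t y \<le> F t x" for t
    unfolding F_def using zero_cube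
    by (intro continuous_attains_sup compact_cube) (auto intro!: continuous_intros contK)
  then obtain X where X: "\<And>t. X t \<in> cube \<rho>" "\<And>t y. y \<in> cube \<rho> \<Longrightarrow> F t y \<le> F t (X t)"
    by metis
  have sol: "solution t (X t)" for t
    unfolding solution_def
  proof
    fix i
    let ?x = "X t"
    have k0: "real k \<noteq> 0" by (simp add: k_def)
    have *: "((\<lambda>s. (?x + s *\<^sub>R axis i 1) $ j ^ k) has_real_derivative
        (if j = i then k * ?x $ i ^ (k - 1) else 0)) (at 0)" for j
      by (auto simp: axis_def intro!: derivative_eq_intros)
    have "((\<lambda>s. \<Sum>j\<in>UNIV. (?x + s *\<^sub>R axis i 1) $ j ^ k) has_real_derivative
        (\<Sum>j\<in>UNIV. if j = i then k * ?x $ i ^ (k - 1) else 0)) (at 0)"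
      by (intro DERIV_sum *)
    then have "((\<lambda>s. F t (?x + s *\<^sub>R axis i 1)) has_real_derivative
        (f' i t ?x - t ^ 3 * (k * ?x $ i ^ (k - 1)))) (at 0)"
      unfolding F_def by (intro DERIV_diff f' DERIV_cmult) simp
    then have "(\<rho>\<^sup>2 - (?x $ i)\<^sup>2) * (f' i t ?x - t ^ 3 * (k * ?x $ i ^ (k - 1))) = 0"
      using maximum_on_cube_partial[of ?x \<rho> "F t"] X by blast
    then have "(\<rho>\<^sup>2 - (?x $ i)\<^sup>2) * f' i t ?x = k * (\<rho>\<^sup>2 - (?x $ i)\<^sup>2) * (t ^ 3 * ?x $ i ^ (k - 1))"
      by (simp add: algebra_simps)
    then have "(\<rho>\<^sup>2 - (?x $ i)\<^sup>2) * f' i t ?x / k = (\<rho>\<^sup>2 - (?x $ i)\<^sup>2) * (t ^ 3 * ?x $ i ^ (k - 1))"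
      using k0 by (simp only: mult.assoc nonzero_mult_div_cancel_left not_False_eq_True)
    moreover have "Suc k = 2 + (k - 1)" by (simp add: k_def)
    then have "?x $ i ^ Suc k = (?x $ i)\<^sup>2 * ?x $ i ^ (k - 1)" by (simp only: power_add)
    ultimately show "t ^ 3 * ?x $ i ^ Suc k = R i t ?x"
      unfolding R_def by (simp add: algebra_simps)
  qed
  obtain g E where g: "degree g = N" "lead_coeff g = 1"
    "\<And>t x. solution t x \<Longrightarrow> poly (map_poly (\<lambda>c. poly c t) g) (t ^ E * F t x) = 0"
    using algebraic_on_solutions[OF F_pp] unfolding N k_def by blast
  have N1: "N \<ge> 1" unfolding N One_nat_def by (intro Suc_leI card_exponents_upto_pos)
  define w where "w t = F t (X t) / t\<^sup>2" for t
  have pen: "(\<Sum>i\<in>UNIV. x $ i ^ k) \<ge> 0" for x :: "real ^ 'n"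
    by (intro sum_nonneg zero_le_even_power) (simp add: k_def)
  have nonneg: "F t (X t) \<ge> 0" if "t > 0" for t
  proof -
    have "0 \<le> F t 0" using that by (simp add: F_def q0 k_def)
    then show ?thesis using X(2)[OF zero_cube, of t] by (rule order_trans)
  qed
  have ev_pos: "\<forall>\<^sub>F t in at_right 0. t > (0::real)" by (rule eventually_at_right_less)
  obtain C0 where C0: "C0 > 0" "\<And>x. x \<in> cube \<rho> \<Longrightarrow> (p x)\<^sup>2 \<le> C0"
  proof -
    have "compact ((\<lambda>x. (p x)\<^sup>2) ` cube \<rho>)"
      by (intro compact_continuous_image continuous_intros contK compact_cube)
    then obtain C0 where "C0 > 0" "\<forall>y\<in>(\<lambda>x. (p x)\<^sup>2) ` cube \<rho>. norm y \<le> C0"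
      using compact_imp_bounded bounded_pos by blast
    then show thesis using that by simp
  qed
  have w_lim: "(w \<longlongrightarrow> 0) (at_right 0)"
  proof (rule order_tendstoI)
    fix a :: real assume "a < 0"
    show "\<forall>\<^sub>F t in at_right 0. a < w t"
      using ev_pos
    proof eventually_elim
      case (elim t)
      then have "w t \<ge> 0" using nonneg by (simp add: w_def)
      then show ?case using \<open>a < 0\<close> by linarith
    qed
  next
    fix a :: real assume a: "0 < a"
    define \<eta> where "\<eta> = min 1 a"
    have \<eta>: "0 < \<eta>" "\<eta> ^ 4 \<le> a"
      using a power_decreasing[of 1 4 \<eta>] by (auto simp: \<eta>_def min_le_iff_disj)
    \<comment> \<open>On the compact set \<open>L\<close> the function \<open>q\<close> has no zero,
      since \<open>s\<close> vanishes where \<open>q\<close> does; so \<open>\<bar>q x\<bar>\<close>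
      is bounded below there by some \<open>e > 0\<close>. A maximiser has
      \<open>q x ^ 4 \<le> t * C0\<close>, which for small \<open>t\<close> keeps it outside
      \<open>L\<close>.\<close>
    define L where "L = cube \<rho> \<inter> {x. \<eta> \<le> \<bar>s x\<bar>}"
    have "closedin (top_of_set (cube \<rho>)) L"
      unfolding L_def using continuous_closedin_preimage[OF continuous_on_rabs[OF cont(3)], of "{\<eta>..}"]
      by (simp add: vimage_def Int_def)
    then have "compact L" using compact_cube closedin_compact by blast
    obtain e where e: "e > 0" "\<And>x. x \<in> L \<Longrightarrow> e \<le> \<bar>q x\<bar>"
    proof (cases "L = {}")
      case True
      then show ?thesis using that[of 1] by simp
    next
      case False
      have "continuous_on L (\<lambda>x. \<bar>q x\<bar>)"
        using continuous_on_subset[OF cont(2)] by (intro continuous_intros) auto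
      then obtain x where x: "x \<in> L" "\<forall>y\<in>L. \<bar>q x\<bar> \<le> \<bar>q y\<bar>"
        using continuous_attains_inf[OF \<open>compact L\<close> False] by blast
      moreover have "q x \<noteq> 0" using sq[of x] x(1) \<eta> by (auto simp: L_def)
      ultimately show ?thesis using that[of "\<bar>q x\<bar>"] by auto
    qed
    have "\<forall>\<^sub>F t in at_right 0. t < e ^ 4 / C0"
      using e(1) C0(1) by (intro eventually_at_right_real[of 0 "e ^ 4 / C0", THEN eventually_mono]) auto
    then show "\<forall>\<^sub>F t in at_right 0. w t < a"
      using ev_pos
    proof eventually_elim
      case (elim t)
      define x where "x = X t"
      have x: "x \<in> cube \<rho>" using X by (simp add: x_def)
      have up: "F t x \<le> t * (p x)\<^sup>2 - q x ^ 4" using pen[of x] elim by (simp add: F_def)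
      then have "q x ^ 4 \<le> t * (p x)\<^sup>2" using nonneg[of t] elim by (simp add: x_def)
      also have "\<dots> \<le> t * C0" using C0(2)[OF x] elim by simp
      also have "\<dots> < e ^ 4" using elim C0 by (simp add: field_simps)
      finally have "\<bar>q x\<bar> ^ 4 < e ^ 4" by simp
      then have "\<bar>q x\<bar> < e" by (rule power_less_imp_less_base) (use e(1) in simp)
      then have "x \<notin> L" using e(2) by fastforce
      then have "\<bar>s x\<bar> \<le> \<eta>" using x by (simp add: L_def)
      then have "(s x)\<^sup>2 \<le> \<eta>\<^sup>2" by (metis abs_ge_zero power2_abs power_mono)
      then have "(p x)\<^sup>2 \<le> \<eta>\<^sup>2 * (q x)\<^sup>2"
        using ps[OF x] by (simp add: power_mult_distrib mult_right_mono)
      then have "t * (p x)\<^sup>2 \<le> t * (\<eta>\<^sup>2 * (q x)\<^sup>2)" using elim by simp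
      \<comment> \<open>Completing the square in \<open>(q x)\<^sup>2\<close> bounds the maximum by
        a small multiple of \<open>t\<^sup>2\<close>.\<close>
      moreover have "0 \<le> ((q x)\<^sup>2 - t * \<eta>\<^sup>2 / 2)\<^sup>2" by simp
      then have "t * (\<eta>\<^sup>2 * (q x)\<^sup>2) - q x ^ 4 \<le> t\<^sup>2 * \<eta> ^ 4 / 4"
        by (simp add: power2_eq_square power4_eq_xxxx algebra_simps)
      ultimately have "F t x \<le> t\<^sup>2 * \<eta> ^ 4 / 4" using up by linarith
      then have "w t \<le> \<eta> ^ 4 / 4" using elim by (simp add: w_def x_def field_simps)
      then show "w t < a" using \<eta> a by linarith
    qed
  qed
  have "\<exists>C>0. \<forall>\<^sub>F t in at_right 0. w t ^ degree g \<le> C * t"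
  proof (rule small_algebraic_function_bound[OF g(2) _ w_lim])
    show "degree g \<ge> 1" using g N1 by simp
    \<comment> \<open>The two extra powers of t undo the division by \<open>t\<^sup>2\<close> in
      \<open>w\<close>.\<close>
    show "\<forall>\<^sub>F t in at_right 0. w t \<ge> 0 \<and> poly (map_poly (\<lambda>c. poly c t) g) (t ^ (E + 2) * w t) = 0"
      using ev_pos
    proof eventually_elim
      case (elim t)
      then have "t ^ (E + 2) * w t = t ^ E * F t (X t)"
        by (simp add: w_def power_add power2_eq_square field_simps)
      then show ?case using g(3)[OF sol] nonneg[of t] elim by (simp add: w_def)
    qed
  qed
  then obtain C1 where C1: "C1 > 0" "\<forall>\<^sub>F t in at_right 0. w t ^ N \<le> C1 * t"
    using g by auto
  define B where "B = CARD('n) * \<rho> ^ k"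
  have B: "(\<Sum>i\<in>UNIV. x $ i ^ k) \<le> B" if "x \<in> cube \<rho>" for x :: "real ^ 'n"
  proof -
    have "x $ i ^ k \<le> \<rho> ^ k" for i
      using that \<rho> power_mono[of "\<bar>x $ i\<bar>" \<rho> k] by (simp add: cube_def k_def flip: power_abs)
    then show ?thesis unfolding B_def using sum_bounded_above[of UNIV "\<lambda>i. x $ i ^ k" "\<rho> ^ k"] by simp
  qed
  have "\<forall>\<^sub>F t in at_right 0. 0 \<le> w t \<and> w t ^ N \<le> max C1 B * t \<and>
    (\<forall>x\<in>cube \<rho>. (p x)\<^sup>2 \<le> q x ^ 4 / t + max C1 B * t\<^sup>2 + t * w t)"
    using C1(2) ev_pos
  proof eventually_elim
    case (elim t)
    have "(p x)\<^sup>2 \<le> q x ^ 4 / t + max C1 B * t\<^sup>2 + t * w t" if x: "x \<in> cube \<rho>" for x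
    proof -
      have "F t x \<le> t\<^sup>2 * w t" using X(2)[OF x, of t] elim by (simp add: w_def)
      moreover have "t ^ 3 * (\<Sum>i\<in>UNIV. x $ i ^ k) \<le> t ^ 3 * max C1 B"
        using B[OF x] elim by (intro mult_left_mono) auto
      ultimately have "t * (p x)\<^sup>2 \<le> q x ^ 4 + t ^ 3 * max C1 B + t\<^sup>2 * w t"
        by (simp add: F_def)
      also have "\<dots> = t * (q x ^ 4 / t + max C1 B * t\<^sup>2 + t * w t)"
        using elim by (simp add: field_simps power2_eq_square power3_eq_cube)
      finally show ?thesis using elim by simp
    qed
    moreover have "w t ^ N \<le> max C1 B * t" using elim by (auto intro: order_trans mult_right_mono)
    ultimately show ?case using nonneg[of t] elim by (simp add: w_def)
  qed
  moreover have "max C1 B > 0" using C1 by simp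
  ultimately show ?thesis by blast
qed

text \<open>Since \<open>2 * b = 1 / N\<close>, the bound on \<open>w t ^ N\<close> gives
  \<open>w t \<le> (C * t) powr (2 * b)\<close>. With \<open>t = u powr (2 - b)\<close> the three
  terms have exponents \<open>2 + b\<close>, \<open>4 - 2 * b\<close> and
  \<open>(2 - b) * (1 + 2 * b)\<close> in \<open>u\<close>; the last two are at least
  \<open>2 + b\<close> because \<open>b \<le> 1 / 2\<close>.\<close>

lemma max_bound_power_saving:
  fixes p q :: "'a \<Rightarrow> real" and w :: "real \<Rightarrow> real"
  assumes N: "N \<ge> 1" and C: "C > 0"
    and b: "b = 1 / (2 * real N)"
    and ev: "\<forall>\<^sub>F t in at_right 0. 0 \<le> w t \<and> w t ^ N \<le> C * t \<and>
      (\<forall>x\<in>K. (p x)\<^sup>2 \<le> q x ^ 4 / t + C * t\<^sup>2 + t * w t)"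
  shows "\<exists>D>0. \<forall>\<^sub>F u in at_right 0. \<forall>x\<in>K. \<bar>q x\<bar> = u \<longrightarrow> (p x)\<^sup>2 \<le> D * u powr (2 + b)"
proof -
  have b01: "0 < b" "b \<le> 1 / 2" using N by (auto simp: b field_simps)
  have lim: "filterlim (\<lambda>u::real. u powr (2 - b)) (at_right 0) (at_right 0)"
  proof (rule filterlim_at_withinI)
    have "((\<lambda>u::real. u) \<longlongrightarrow> 0) (at_right 0)" by (rule tendsto_ident_at)
    then show "((\<lambda>u::real. u powr (2 - b)) \<longlongrightarrow> 0) (at_right 0)"
      using b01 eventually_at_right_less[of "0::real"]
      by (intro tendsto_zero_powrI[of _ _ _ "2 - b"]) (auto elim: eventually_mono)
    show "\<forall>\<^sub>F u::real in at_right 0. u powr (2 - b) \<in> {0<..} - {0}"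
      using eventually_at_right_less[of "0::real"] by eventually_elim auto
  qed
  define D where "D = 1 + C + C powr (2 * b)"
  have "\<forall>\<^sub>F u in at_right 0. \<forall>x\<in>K. \<bar>q x\<bar> = u \<longrightarrow> (p x)\<^sup>2 \<le> D * u powr (2 + b)"
    using eventually_compose_filterlim[OF ev lim] eventually_at_right_less[of "0::real"]
      eventually_at_right_real[of 0 1, simplified]
  proof eventually_elim
    case (elim u)
    \<comment> \<open>This \<open>t\<close> makes all three terms of the bound at most of order \<open>u powr (2 + b)\<close>.\<close>
    define t where "t = u powr (2 - b)"
    have u: "0 < u" "u \<le> 1" and t: "t > 0" using elim by (auto simp: t_def)
    have w: "0 \<le> w t" "w t ^ N \<le> C * t" using elim by (auto simp: t_def)
    have pw: "u powr a \<le> u powr (2 + b)" if "2 + b \<le> a" for a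
      using that u by (intro powr_mono') auto
    have "w t \<le> C powr (2 * b) * u powr ((2 - b) * (2 * b))"
    proof (cases "w t = 0")
      case False
      then have "w t = (w t ^ N) powr (2 * b)"
        using w N by (simp add: b powr_powr flip: powr_realpow)
      also have "\<dots> \<le> (C * t) powr (2 * b)"
        using w b01 by (intro powr_mono2) auto
      also have "\<dots> = C powr (2 * b) * u powr ((2 - b) * (2 * b))"
        using C t by (simp add: powr_mult t_def powr_powr)
      finally show ?thesis .
    qed simp
    then have "t * w t \<le> t * (C powr (2 * b) * u powr ((2 - b) * (2 * b)))"
      using t by (intro mult_left_mono) auto
    also have "\<dots> = C powr (2 * b) * u powr ((2 - b) + (2 - b) * (2 * b))"
      by (simp add: t_def powr_add)
    also have "\<dots> \<le> C powr (2 * b) * u powr (2 + b)"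
    proof -
      have "b * b \<le> b * (1 / 2)" using b01 by (intro mult_left_mono) auto
      then have "2 + b \<le> (2 - b) + (2 - b) * (2 * b)" using b01 by (simp add: algebra_simps)
      then show ?thesis by (intro mult_left_mono pw) auto
    qed
    finally have 3: "t * w t \<le> C powr (2 * b) * u powr (2 + b)" .
    have "t\<^sup>2 = u powr (4 - 2 * b)"
      using u by (simp add: t_def powr_power mult.commute algebra_simps)
    also have "\<dots> \<le> u powr (2 + b)" using b01 by (intro pw) simp
    finally have 2: "C * t\<^sup>2 \<le> C * u powr (2 + b)" using C by simp
    have 1: "u ^ 4 / t = u powr (2 + b)"
      using u by (simp add: t_def flip: powr_diff powr_numeral)
    show ?case
    proof (intro ballI impI)
      fix x assume x: "x \<in> K" "\<bar>q x\<bar> = u"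
      then have "q x ^ 4 = u ^ 4" using power_even_abs[of 4 "q x"] by simp
      then have "(p x)\<^sup>2 \<le> u ^ 4 / t + C * t\<^sup>2 + t * w t" using elim x by (auto simp: t_def)
      also have "\<dots> \<le> D * u powr (2 + b)" using 1 2 3 by (simp add: D_def algebra_simps)
      finally show "(p x)\<^sup>2 \<le> D * u powr (2 + b)" .
    qed
  qed
  moreover have "D > 0" using C by (simp add: D_def add_pos_nonneg)
  ultimately show ?thesis by blast
qed

subsection \<open>Continuity\<close>

text \<open>Along the line through \<open>x\<close> and \<open>y\<close>, \<open>Q\<close> is a
  univariate polynomial that is nonzero at parameter 1, so it has finitely many roots. Every point
  is thus a limit of points where \<open>Q\<close> does not vanish.\<close>

lemma nonzero_polynomial_on_segments:
  fixes Q :: "'a::euclidean_space \<Rightarrow> real"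
  assumes "real_polynomial_function Q" "Q y \<noteq> 0"
  shows "\<forall>\<^sub>F u in at_right 0. Q (x + u *\<^sub>R (y - x)) \<noteq> 0"
proof -
  define g where "g u = Q (x + u *\<^sub>R (y - x))" for u
  have "polynomial_function (\<lambda>u::real. x + u *\<^sub>R (y - x))"
    by (intro polynomial_function_add polynomial_function_const
        polynomial_function_bounded_linear bounded_linear_scaleR_left)
  then have "real_polynomial_function g"
    unfolding g_def[abs_def] using real_polynomial_function_compose[OF _ assms(1)] by (simp add: o_def)
  then obtain a n where a: "g = (\<lambda>u. \<Sum>i\<le>n. a i * u ^ i)"
    unfolding real_polynomial_function_iff_sum by blast
  have "\<exists>i\<le>n. a i \<noteq> 0"
  proof (rule ccontr)
    assume "\<not> ?thesis"
    then have "g 1 = 0" unfolding a by (intro sum.neutral) auto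
    then show False using assms(2) by (simp add: g_def)
  qed
  then have "finite {u. g u = 0}"
    unfolding a using polyfun_finite_roots by blast
  \<comment> \<open>The parameter 0 is taken out because \<open>Q x\<close> itself may be 0.\<close>
  then have "closed ({u. g u = 0} - {0})" by (intro finite_imp_closed) simp
  then have "\<forall>\<^sub>F u in nhds 0. u \<in> - ({u. g u = 0} - {0})"
    by (intro eventually_nhds_in_open open_Compl) auto
  then have "\<forall>\<^sub>F u in at_right 0. u \<in> - ({u. g u = 0} - {0})"
    by (auto simp: eventually_at_filter elim: eventually_mono)
  then show ?thesis
    using eventually_at_right_less[of "0::real"] by eventually_elim (auto simp: g_def)
qed

text \<open>Where \<open>Q\<close> vanishes this says \<open>P x = 0\<close>. It follows by
  continuity along a segment on which \<open>Q\<close> is nonzero near \<open>x\<close> and the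
  identity is immediate.\<close>

lemma numerator_eq_quotient_times_denominator:
  fixes P Q :: "real ^ 'n \<Rightarrow> real"
  assumes P: "real_polynomial_function P" and Q: "real_polynomial_function Q" "Q \<noteq> (\<lambda>x. 0)"
    and cont: "continuous_on (ball x0 r) (s_fun P Q)" and x: "x \<in> ball x0 r"
  shows "P x = s_fun P Q x * Q x"
proof (cases "Q x = 0")
  case True
  obtain y where y: "Q y \<noteq> 0" using Q(2) by blast
  let ?h = "\<lambda>u. x + u *\<^sub>R (y - x)"
  have h: "(?h \<longlongrightarrow> x) (at_right 0)" by (auto intro!: tendsto_eq_intros)
  have isCont: "isCont P x" "isCont Q x"
    using P Q(1) by (auto intro: continuous_real_polymonial_function)
  have s_cont: "isCont (s_fun P Q) x"
    using cont x by (simp add: continuous_on_eq_continuous_at)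
  have "((\<lambda>u. s_fun P Q (?h u) * Q (?h u)) \<longlongrightarrow> s_fun P Q x * Q x) (at_right 0)"
    by (rule tendsto_mult[OF isCont_tendsto_compose[OF s_cont h] isCont_tendsto_compose[OF isCont(2) h]])
  moreover have "\<forall>\<^sub>F u in at_right 0. s_fun P Q (?h u) * Q (?h u) = P (?h u)"
    using nonzero_polynomial_on_segments[OF Q(1) y, of x]
    by eventually_elim (simp add: s_fun_def zero_set_def)
  ultimately have "((\<lambda>u. P (?h u)) \<longlongrightarrow> s_fun P Q x * Q x) (at_right 0)"
    by (rule Lim_transform_eventually)
  moreover have "((\<lambda>u. P (?h u)) \<longlongrightarrow> P x) (at_right 0)"
    by (rule isCont_tendsto_compose[OF isCont(1) h])
  ultimately show ?thesis
    by (rule tendsto_unique[OF trivial_limit_at_right_real, rotated])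
qed (simp add: s_fun_def zero_set_def)

section \<open>Assembly of the local bounds into continuity on the ball\<close>

theorem lemma4p1:
  fixes P Q :: "real ^ 'n \<Rightarrow> real" and x0 :: "real ^ 'n" and r :: real
  assumes "r > 0"
    and "real_polynomial_function P"
    and "real_polynomial_function Q"
    and "Q \<noteq> (\<lambda>x. 0)"
    and "continuous_on (ball x0 r) (s_fun P Q)"
  shows "\<exists>\<phi>::rat. \<phi> > 0 \<and> continuous_on (ball x0 r) (s_pow \<phi> P Q)"
proof -
  note P = assms(2) and Q = assms(3)
  have cont: "isCont P x" "isCont Q x" for x
    using P Q continuous_real_polymonial_function by auto
  obtain dP where dP: "\<And>z. param_poly dP (\<lambda>t x. P (z + x))"
    using param_poly_of_real_polynomial_function[OF P] by blast
  obtain dQ where dQ: "\<And>z. param_poly dQ (\<lambda>t x. Q (z + x))"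
    using param_poly_of_real_polynomial_function[OF Q] by blast
  define d where "d = 2 * dP + 4 * dQ"
  have pp: "param_poly d (\<lambda>t x. t * P (z + x) ^ 2 - Q (z + x) ^ 4)" for z
  proof -
    have "param_poly d (\<lambda>t x. poly [:0, 1:] t * P (z + x) ^ 2)"
      by (intro param_poly_cmult param_poly_mono[OF param_poly_power[OF dP]]) (simp add: d_def)
    moreover have "param_poly d (\<lambda>t x. Q (z + x) ^ 4)"
      by (intro param_poly_mono[OF param_poly_power[OF dQ]]) (simp add: d_def)
    ultimately show ?thesis using param_poly_diff by fastforce
  qed
  define N where "N = card (exponents_upto (2 * d + 2) :: ('n \<Rightarrow> nat) set)"
  have N: "N \<ge> 1" unfolding N_def One_nat_def by (intro Suc_leI card_exponents_upto_pos)
  define b where "b = 1 / (2 * real N)"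
  \<comment> \<open>This is \<open>b / 4\<close>, fixed before any point \<open>z\<close> is chosen.
    Near a zero of \<open>Q\<close>, \<open>\<bar>P x\<bar>\<close> is at most a constant times
    \<open>\<bar>Q x\<bar> powr (1 + b / 2)\<close>, so division by
    \<open>\<bar>Q x\<bar> powr (1 + b / 4)\<close> leaves a positive power of
    \<open>\<bar>Q x\<bar>\<close>.\<close>
  define \<phi> :: rat where "\<phi> = 1 / (8 * of_nat N)"
  have \<phi>: "\<phi> > 0" "real_of_rat \<phi> = b / 4"
    using N by (simp_all add: \<phi>_def b_def of_rat_divide of_rat_mult)
  have b: "b > 0" using N by (simp add: b_def)
  have "isCont (s_pow \<phi> P Q) z" if z: "z \<in> ball x0 r" for z
  proof (cases "Q z = 0")
    case False
    have "isCont (\<lambda>x. \<bar>P x\<bar> / \<bar>Q x\<bar> powr (1 + real_of_rat \<phi>)) z"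
      using False by (intro continuous_intros cont) auto
    moreover have "\<forall>\<^sub>F x in nhds z. Q x \<noteq> 0"
      using tendsto_imp_eventually_ne[OF cont(2)[of z, unfolded isCont_def tendsto_at_iff_tendsto_nhds] False] .
    then have "\<forall>\<^sub>F x in nhds z. s_pow \<phi> P Q x = \<bar>P x\<bar> / \<bar>Q x\<bar> powr (1 + real_of_rat \<phi>)"
      by eventually_elim (simp add: s_pow_def zero_set_def)
    ultimately show ?thesis by (simp add: isCont_cong)
  next
    case True
    obtain \<epsilon> where \<epsilon>: "\<epsilon> > 0" "ball z \<epsilon> \<subseteq> ball x0 r"
      using z open_ball openE by metis
    \<comment> \<open>\<open>CARD('n)\<close> comes from bounding the Euclidean norm by the sum of
      the coordinates' absolute values; the factor 2 makes the bound by \<open>\<epsilon>\<close>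
      strict.\<close>
    define \<rho> where "\<rho> = \<epsilon> / (2 * CARD('n))"
    have \<rho>: "\<rho> > 0" using \<epsilon> by (simp add: \<rho>_def)
    have in_ball: "z + x \<in> ball x0 r" if "x \<in> cube \<rho>" for x
    proof -
      have "norm x \<le> (\<Sum>i\<in>UNIV. \<bar>x $ i\<bar>)" by (rule norm_le_l1_cart)
      also have "\<dots> \<le> CARD('n) * \<rho>"
        using that sum_bounded_above[of UNIV "\<lambda>i. \<bar>x $ i\<bar>" \<rho>] by (simp add: cube_def)
      also have "\<dots> < \<epsilon>" using \<epsilon> by (simp add: \<rho>_def)
      finally have "z + x \<in> ball z \<epsilon>" by (simp add: dist_norm)
      then show ?thesis using \<epsilon>(2) by blast
    qed
    have s_cont: "continuous_on (cube \<rho>) (\<lambda>x. s_fun P Q (z + x))"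
      using in_ball by (intro continuous_on_compose2[OF assms(5)] continuous_intros) auto
    have shift: "continuous_on UNIV (\<lambda>x. f (z + x))" if "\<And>x. isCont f x"
      for f :: "real ^ 'n \<Rightarrow> real"
      by (intro continuous_at_imp_continuous_on ballI isCont_o2[where f = "\<lambda>x. z + x", OF _ that]
          continuous_intros)
    have "\<exists>C>0. \<exists>w. \<forall>\<^sub>F t in at_right 0. 0 \<le> w t \<and> w t ^ N \<le> C * t \<and>
        (\<forall>x\<in>cube \<rho>. (P (z + x))\<^sup>2 \<le> Q (z + x) ^ 4 / t + C * t\<^sup>2 + t * w t)"
    proof (rule penalised_maximum_bound[OF pp shift[OF cont(1)] shift[OF cont(2)] s_cont _ _ _ \<rho> N_def])
      show "P (z + x) = s_fun P Q (z + x) * Q (z + x)" if "x \<in> cube \<rho>" for x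
        using numerator_eq_quotient_times_denominator[OF P Q assms(4,5) in_ball[OF that]] .
    qed (simp_all add: True s_fun_def zero_set_def)
    then obtain C w where C: "C > 0"
      "\<forall>\<^sub>F t in at_right 0. 0 \<le> w t \<and> w t ^ N \<le> C * t \<and>
        (\<forall>x\<in>cube \<rho>. (P (z + x))\<^sup>2 \<le> Q (z + x) ^ 4 / t + C * t\<^sup>2 + t * w t)"
      by blast
    obtain D where D: "D > 0"
      "\<forall>\<^sub>F u in at_right 0. \<forall>x\<in>cube \<rho>. \<bar>Q (z + x)\<bar> = u \<longrightarrow> (P (z + x))\<^sup>2 \<le> D * u powr (2 + b)"
      using max_bound_power_saving[OF N C(1) b_def C(2)] by blast
    obtain e where e: "e > 0"
      "\<And>u x. 0 < u \<Longrightarrow> u < e \<Longrightarrow> x \<in> cube \<rho> \<Longrightarrow> \<bar>Q (z + x)\<bar> = u \<Longrightarrow>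
        (P (z + x))\<^sup>2 \<le> D * u powr (2 + b)"
      using D(2) unfolding eventually_at_right_field by blast
    have bound: "s_pow \<phi> P Q x \<le> sqrt D * \<bar>Q x\<bar> powr (b / 4)"
      if x: "x - z \<in> cube \<rho>" "\<bar>Q x\<bar> < e" for x
    proof (cases "Q x = 0")
      case False
      define u where "u = \<bar>Q x\<bar>"
      have u: "u > 0" using False by (simp add: u_def)
      have "(P x)\<^sup>2 \<le> D * u powr (2 + b)"
        using e(2)[of u "x - z"] x u by (simp add: u_def)
      also have "\<dots> = (sqrt D * u powr (1 + b / 2))\<^sup>2"
        using D(1) u by (simp add: power_mult_distrib powr_power)
      finally have "\<bar>P x\<bar> \<le> sqrt D * u powr (1 + b / 2)"
        using D(1) by (simp add: abs_le_square_iff[symmetric] abs_mult)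
      then have "\<bar>P x\<bar> / u powr (1 + b / 4) \<le> sqrt D * (u powr (1 + b / 2) / u powr (1 + b / 4))"
        by (simp add: divide_right_mono)
      also have "u powr (1 + b / 2) / u powr (1 + b / 4) = u powr (b / 4)"
        by (simp flip: powr_diff)
      finally show ?thesis
        using False by (simp add: s_pow_def zero_set_def \<phi>(2) u_def)
    qed (simp add: s_pow_def zero_set_def)
    have near: "\<forall>\<^sub>F x in at z. x - z \<in> cube \<rho>"
    proof -
      have "\<forall>\<^sub>F x in at z. dist x z < \<rho>" using \<rho> by (auto simp: eventually_at)
      then show ?thesis
        by eventually_elim
          (use component_le_norm_cart order_trans less_imp_le in \<open>fastforce simp: cube_def dist_norm\<close>)
    qed
    have Q_lim: "((\<lambda>x. \<bar>Q x\<bar>) \<longlongrightarrow> 0) (at z)"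
      using cont(2)[of z] True by (auto simp: isCont_def intro!: tendsto_rabs_zero)
    then have small: "\<forall>\<^sub>F x in at z. \<bar>Q x\<bar> < e" using e(1) by (rule order_tendstoD)
    have "((\<lambda>x. sqrt D * \<bar>Q x\<bar> powr (b / 4)) \<longlongrightarrow> 0) (at z)"
      using b by (intro tendsto_mult_right_zero tendsto_zero_powrI[OF Q_lim tendsto_const]) auto
    then have "(s_pow \<phi> P Q \<longlongrightarrow> 0) (at z)"
    proof (rule Lim_null_comparison[rotated])
      show "\<forall>\<^sub>F x in at z. norm (s_pow \<phi> P Q x) \<le> sqrt D * \<bar>Q x\<bar> powr (b / 4)"
        using near small
      proof eventually_elim
        case (elim x)
        moreover have "s_pow \<phi> P Q x \<ge> 0" by (simp add: s_pow_def)
        ultimately show ?case using bound by simp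
      qed
    qed
    then show ?thesis using True by (simp add: isCont_def s_pow_def zero_set_def)
  qed
  then have "continuous_on (ball x0 r) (s_pow \<phi> P Q)"
    by (simp add: continuous_at_imp_continuous_on)
  with \<phi>(1) show ?thesis by blast
qed

end
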